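(* Fix $0<\beta\le\beta_c$ (so $(\beta,K(\beta))$ is a second-order point if $\beta<\beta_c$ and the tricritical point if $\beta=\beta_c$). For each $\alpha>0$ let $(\beta_n,K_n)=(\beta_n^{(\alpha)},K_n^{(\alpha)})$, $n\in\mathbb N$, be a sequence of pairs of positive numbers converging to $(\beta,K(\beta))$. Assume the following. (i) $(\beta_n,K_n)$ lies in the phase-coexistence region for all sufficiently large $n$. (ii) The limits $b=\lim_{n\to\infty}n^{\alpha}(\beta_n-\beta)$ and $k=\lim_{n\to\infty}n^{\alpha}(K_n-K(\beta))$ both exist and are not both $0$; if $b\neq0$, then $b\in\{1,-1\}$. (iii) There exist an even polynomial $g$ of degree $4$ or $6$ with $g(x)\to\infty$ as $|x|\to\infty$, and numbers $\alpha_0>0$ and $\theta>0$, such that: (a) for $\alpha=\alpha_0$, $\lim_{n\to\infty}n^{\alpha/\alpha_0}G_{\beta_n,K_n}(x/n^{\theta\alpha})=g(x)$ (that is, $\lim_{n\to\infty}nG_{\beta_n,K_n}(x/n^{\theta\alpha_0})=g(x)$) uniformly for $x$ in compact subsets of $\mathbb R$; (b) $g$ has a unique positive global minimum point $\bar x$ (thus the set of global minimum points of $g$ equals $\{\pm\bar x\}$ or $\{0,\pm\bar x\}$). (iv) There exists a polynomial $H$ with $H(x)\to\infty$ as $|x|\to\infty$ such that, for $\alpha=\alpha_0$, there exists $R>0$ such that for all sufficiently large $n\in\mathbb N$ and all $x\in\mathbb R$ with $|x/n^{\theta\alpha_0}|<R$, one has $nG_{\beta_n,K_n}(x/n^{\theta\alpha_0})\ge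 H(x)$. Assume also that $0<\theta\alpha_0<1/2$. Then: (a) Defining $$\bar z=\frac{1}{\int_{\mathbb R}\exp[-g(x)]\,dx}\cdot\int_{\mathbb R}|x|\exp[-g(x)]\,dx,$$ for $\alpha=\alpha_0$ one has $E_{n,\beta_n,K_n}\{|S_n/n|\}\sim\bar z/n^{\theta\alpha_0}$, that is, $\lim_{n\to\infty}n^{\theta\alpha_0}E_{n,\beta_n,K_n}\{|S_n/n|\}=\bar z$. (b) For $\alpha=\alpha_0$, $E_{n,\beta_n,K_n}\{|S_n/n|\}\sim\bar z\cdot m(\beta_n,K_n)/\bar x$.
   Context: Mean-field Blume--Capel model. Let $\Lambda=\{1,0,-1\}$. For $n\in\mathbb N$, $K>0$ and $\omega=(\omega_1,\dots,\omega_n)\in\Lambda^n$ put $S_n(\omega)=\sum_{j=1}^n\omega_j$ and $H_{n,K}(\omega)=\sum_{j=1}^n\omega_j^2-\frac Kn\bigl(\sum_{j=1}^n\omega_j\bigr)^2$. For $\beta>0$, $P_{n,\beta,K}$ is the probability measure on $\Lambda^n$ giving $\omega$ probability proportional to $\exp[-\beta H_{n,K}(\omega)]$; $E_{n,\beta,K}$ denotes expectation with respect to $P_{n,\beta,K}$. Free-energy functional: $c_\beta(t)=\log\frac{1+e^{-\beta}(e^t+e^{-t})}{1+2e^{-\beta}}$ and $G_{\beta,K}(x)=\beta Kx^2-c_\beta(2\beta Kx)$ for $x\in\mathbb R$. $\mathcal M_{\beta,K}$ is the set of global minimum points of $G_{\beta,K}$. Let $\beta_c=\log4$ and $K(\beta)=(e^\beta+2)/(4\beta)$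 for $\beta>0$. The points $(\beta,K(\beta))$ with $0<\beta<\beta_c$ are called second-order points and $(\beta_c,K(\beta_c))$ the tricritical point. The phase-coexistence region is the set of $(\beta,K)$, $\beta,K>0$, for which $\mathcal M_{\beta,K}$ has more than one element. It is known that for such $(\beta,K)$, $\mathcal M_{\beta,K}$ is $\{\pm m(\beta,K)\}$ or $\{0,\pm m(\beta,K)\}$ with $m(\beta,K)>0$; this unique positive global minimum point $m(\beta,K)$ is the thermodynamic magnetization. Notation: $a_n\sim b_n$ means $a_n/b_n\to1$ as $n\to\infty$. The quantity $m(\beta_n,K_n)$ is considered for $n$ large enough that $(\beta_n,K_n)$ lies in the phase-coexistence region. *)

theory Defs
  imports "HOL-Probability.Probability" "HOL-Library.Landau_Symbols"
    "HOL-Computational_Algebra.Polynomial"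
begin

unbundle asymp_equiv_syntax

text \<open>Configurations are the functions from \<open>{1..n}\<close> to \<open>{1,0,-1}\<close>; outside of
  \<open>{1..n}\<close> they take the dummy value \<open>undefined\<close>, so that there are exactly \<open>3 ^ n\<close> of them.\<close>

definition configs :: "nat \<Rightarrow> (nat \<Rightarrow> real) set" where
  "configs n = PiE {1..n} (\<lambda>_. {1, 0, -1})"

definition spin_sum :: "nat \<Rightarrow> (nat \<Rightarrow> real) \<Rightarrow> real" where
  "spin_sum n \<omega> = (\<Sum>j = 1..n. \<omega> j)"

definition hamiltonian :: "nat \<Rightarrow> real \<Rightarrow> (nat \<Rightarrow> real) \<Rightarrow> real" where
  "hamiltonian n K \<omega> = (\<Sum>j = 1..n. (\<omega> j)\<^sup>2) - K / real n * (\<Sum>j = 1..n. \<omega> j)\<^sup>2"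

definition partition_function :: "nat \<Rightarrow> real \<Rightarrow> real \<Rightarrow> real" where
  "partition_function n \<beta> K = (\<Sum>\<omega>\<in>configs n. exp (- \<beta> * hamiltonian n K \<omega>))"

definition blume_capel :: "nat \<Rightarrow> real \<Rightarrow> real \<Rightarrow> (nat \<Rightarrow> real) measure" where
  "blume_capel n \<beta> K = point_measure (configs n)
     (\<lambda>\<omega>. ennreal (exp (- \<beta> * hamiltonian n K \<omega>) / partition_function n \<beta> K))"

lemma prob_space_blume_capel: "prob_space (blume_capel n \<beta> K)"
proof
  have fin: "finite (configs n)"
    unfolding configs_def by (intro finite_PiE) auto
  have "(\<lambda>j. if j \<in> {1..n} then 0 else undefined) \<in> configs n"
    unfolding configs_def by auto
  then have ne: "configs n \<noteq> {}" by blast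
  have pos: "partition_function n \<beta> K > 0"
    unfolding partition_function_def by (intro sum_pos fin ne) auto
  have "emeasure (blume_capel n \<beta> K) (space (blume_capel n \<beta> K))
      = (\<Sum>\<omega>\<in>configs n. ennreal (exp (- \<beta> * hamiltonian n K \<omega>) / partition_function n \<beta> K))"
    unfolding blume_capel_def by (simp add: space_point_measure emeasure_point_measure_finite fin)
  also have "\<dots> = ennreal (\<Sum>\<omega>\<in>configs n. exp (- \<beta> * hamiltonian n K \<omega>) / partition_function n \<beta> K)"
    using pos by (intro sum_ennreal) (simp add: less_imp_le)
  also have "(\<Sum>\<omega>\<in>configs n. exp (- \<beta> * hamiltonian n K \<omega>) / partition_function n \<beta> K) = 1"
    using pos by (simp flip: sum_divide_distrib add: partition_function_def)
  finally show "emeasure (blume_capel n \<beta> K) (space (blume_capel n \<beta> K)) = 1" by simp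
qed

definition mean_abs_magnetization :: "nat \<Rightarrow> real \<Rightarrow> real \<Rightarrow> real" where
  "mean_abs_magnetization n \<beta> K =
     prob_space.expectation (blume_capel n \<beta> K) (\<lambda>\<omega>. \<bar>spin_sum n \<omega> / real n\<bar>)"

definition cgf :: "real \<Rightarrow> real \<Rightarrow> real" where
  "cgf \<beta> t = ln ((1 + exp (- \<beta>) * (exp t + exp (- t))) / (1 + 2 * exp (- \<beta>)))"

definition free_energy :: "real \<Rightarrow> real \<Rightarrow> real \<Rightarrow> real" where
  "free_energy \<beta> K x = \<beta> * K * x\<^sup>2 - cgf \<beta> (2 * \<beta> * K * x)"

definition global_min_points :: "(real \<Rightarrow> real) \<Rightarrow> real set" where
  "global_min_points f = {x. \<forall>y. f x \<le> f y}"

definition critical_beta :: real where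
  "critical_beta = ln 4"

definition critical_K :: "real \<Rightarrow> real" where
  "critical_K \<beta> = (exp \<beta> + 2) / (4 * \<beta>)"

definition phase_coexistence :: "(real \<times> real) set" where
  "phase_coexistence = {(\<beta>, K). \<beta> > 0 \<and> K > 0 \<and>
     (\<exists>x y. x \<in> global_min_points (free_energy \<beta> K) \<and>
            y \<in> global_min_points (free_energy \<beta> K) \<and> x \<noteq> y)}"

text \<open>Only meaningful for \<open>(\<beta>, K)\<close> in \<open>phase_coexistence\<close>, where the positive global
  minimum point exists and is unique.\<close>

definition thermo_magnetization :: "real \<Rightarrow> real \<Rightarrow> real" where
  "thermo_magnetization \<beta> K = (THE x. x > 0 \<and> x \<in> global_min_points (free_energy \<beta> K))"

end

theory Submission
  imports Defs
begin

text \<open>Write \<open>G\<close> for the free-energy functional at \<open>(\<beta>\<^sub>n, K\<^sub>n)\<close> and \<open>s = n powr (\<theta> * \<alpha>0)\<close>.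

Finite-size magnetization. Adding to \<open>S\<^sub>n / n\<close> an independent Gaussian variable of variance
\<open>1 / (2 n \<beta>\<^sub>n K\<^sub>n)\<close> yields a variable with density proportional to \<open>exp (- n G y)\<close>
(\<open>hubbard_stratonovich\<close>). Hence \<open>s E\<bar>S\<^sub>n / n\<bar>\<close> differs from the quotient of the integrals of
\<open>\<bar>x\<bar> exp (- n G (x / s))\<close> and \<open>exp (- n G (x / s))\<close> by at most a bounded multiple of \<open>s / sqrt n\<close>, which tends
to \<open>0\<close> because \<open>\<theta> * \<alpha>0 < 1 / 2\<close>. The integrands converge to those that define \<open>zbar\<close>.
Domination (\<open>free_energy_linear_lower_bound\<close>) comes from the polynomial \<open>H\<close> for \<open>\<bar>x / s\<bar> < R\<close>. For
\<open>\<bar>x / s\<bar> \<ge> R\<close> it rests on the fact that at a second-order or tricritical point the free energy is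
strictly positive away from \<open>0\<close> (\<open>free_energy_critical_pos\<close>): at \<open>K = critical_K \<beta>\<close> this says that
\<open>exp \<beta> + 2 cosh t\<close> is below \<open>(exp \<beta> + 2) exp (t\<^sup>2 / (exp \<beta> + 2))\<close>, and the two power series
can be compared term by term exactly when \<open>exp \<beta> \<le> 4\<close>.

Thermodynamic magnetization. The free energy has at most two positive critical points
(\<open>free_energy_deriv_three_zeros\<close>). This makes the positive global minimum point
unique, and it also shows \<open>s m(\<beta>\<^sub>n, K\<^sub>n) \<longlonglongrightarrow> xbar\<close> (\<open>scaled_magnetization_tendsto\<close>): the rescaled
free energy has a well around \<open>xbar\<close>, and a positive global minimum point outside this well would
entail three positive critical points. Dividing the two limits gives the second claim.\<close>

section \<open>Critical points and the thermodynamic magnetization\<close>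

lemma Rolle_zero:
  fixes f f' :: "real \<Rightarrow> real"
  assumes "\<And>x. (f has_real_derivative f' x) (at x)" and "a < b" and "f a = f b"
  obtains z where "a < z" "z < b" "f' z = 0"
proof -
  have "continuous_on {a..b} f"
    using assms(1) by (meson DERIV_continuous_on has_field_derivative_at_within)
  then obtain z where "a < z" "z < b" "(f has_real_derivative 0) (at z)"
    using Rolle[OF assms(2,3)] assms(1) real_differentiable_def by metis
  with that assms(1) DERIV_unique show ?thesis by blast
qed

lemma interior_max_critical:
  fixes f f' :: "real \<Rightarrow> real"
  assumes deriv: "\<And>x. (f has_real_derivative f' x) (at x)"
    and "a < c" "c < b" "f a < f c" "f b < f c"
  obtains z where "a < z" "z < b" "f' z = 0" "f c \<le> f z"
proof -
  have "continuous_on {a..b} f"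
    using deriv by (meson DERIV_continuous_on has_field_derivative_at_within)
  then obtain z where z: "z \<in> {a..b}" "\<And>y. y \<in> {a..b} \<Longrightarrow> f y \<le> f z"
    using continuous_attains_sup[of "{a..b}" f] assms(2,3) by fastforce
  have "f c \<le> f z" using z(2)[of c] assms by simp
  then have *: "a < z" "z < b" using z(1) assms by (auto simp: less_le)
  have "f' z = 0"
  proof (rule DERIV_local_max[OF deriv])
    show "0 < min (z - a) (b - z)" using * by simp
    show "\<forall>y. \<bar>z - y\<bar> < min (z - a) (b - z) \<longrightarrow> f y \<le> f z"
      using z(2) by (auto simp: abs_if split: if_splits)
  qed
  with that * \<open>f c \<le> f z\<close> show ?thesis by blast
qed

lemma interior_min_critical:
  fixes f f' :: "real \<Rightarrow> real"
  assumes deriv: "\<And>x. (f has_real_derivative f' x) (at x)"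
    and "a < c" "c < b" "f c < f a" "f c < f b"
  obtains z where "a < z" "z < b" "f' z = 0" "f z \<le> f c"
proof -
  have "((\<lambda>x. - f x) has_real_derivative - f' x) (at x)" for x
    using deriv by (rule DERIV_minus)
  from interior_max_critical[OF this assms(2,3)] assms(4,5) that show ?thesis
    by (metis neg_0_equal_iff_equal neg_equal_0_iff_equal neg_le_iff_le neg_less_iff_less)
qed

text \<open>A well is a stretch whose end values both exceed the value at an interior point \<open>q\<close>. If a
global minimum point \<open>y\<close> lay outside, then \<open>f y \<le> f q\<close> would force a local maximum between
\<open>y\<close> and \<open>q\<close> and, beyond it as seen from \<open>y\<close>, a local minimum; together with \<open>y\<close> these are
three positive critical points. A positive global minimum point is thus located by comparing
just three values of \<open>f\<close>, even if \<open>0\<close> is a competing minimum point.\<close>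

lemma global_min_in_well:
  fixes f f' :: "real \<Rightarrow> real"
  assumes deriv: "\<And>x. (f has_real_derivative f' x) (at x)"
    and crit: "\<And>u v w. 0 < u \<Longrightarrow> u < v \<Longrightarrow> v < w \<Longrightarrow> f' u = 0 \<Longrightarrow> f' v = 0 \<Longrightarrow> f' w = 0 \<Longrightarrow> False"
    and well: "0 < p" "p < q" "q < r" "f q < f p" "f q < f r"
    and y: "y > 0" "\<And>x. f y \<le> f x"
  shows "y \<in> {p..r}"
proof (rule ccontr)
  assume out: "y \<notin> {p..r}"
  have y0: "f' y = 0"
    by (rule DERIV_local_min[OF deriv, of 1]) (use y(2) in auto)
  have yq: "f y \<le> f q" by (rule y(2))
  show False
  proof (cases "y < p")
    case True
    obtain s where s: "y < s" "s < q" "f' s = 0" "f p \<le> f s"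
      using interior_max_critical[OF deriv True \<open>p < q\<close>] well yq by auto
    obtain w where "s < w" "w < r" "f' w = 0"
      using interior_min_critical[OF deriv s(2) \<open>q < r\<close>] well s by auto
    with crit[OF y(1) s(1)] y0 s show False by blast
  next
    case False
    then have "r < y" using out by auto
    obtain s where s: "q < s" "s < y" "f' s = 0" "f r \<le> f s"
      using interior_max_critical[OF deriv \<open>q < r\<close> \<open>r < y\<close>] well yq by auto
    obtain w where "p < w" "w < s" "f' w = 0"
      using interior_min_critical[OF deriv \<open>p < q\<close> s(1)] well s by auto
    with crit[of w s y] y0 s well show False by force
  qed
qed

text \<open>Rolle's theorem, applied three times to \<open>\<phi> t = \<kappa> t (a + 2 cosh t) - 2 sinh t\<close>. Since \<open>\<phi>\<close>
and its second derivative vanish at \<open>0\<close> as well, three positive zeros of \<open>\<phi>\<close> give three of the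
first derivative, two of the second and again two of the third. But the third derivative divided
by \<open>cosh t\<close> is a constant plus \<open>2 \<kappa> t tanh t\<close>, which is strictly increasing for positive \<open>t\<close>.\<close>

lemma sinh_cosh_three_zeros:
  fixes \<kappa> a :: real
  assumes \<kappa>: "\<kappa> > 0" and "0 < u" "u < v" "v < w"
    and zero: "\<And>t. t \<in> {u, v, w} \<Longrightarrow> \<kappa> * t * (a + 2 * cosh t) = 2 * sinh t"
  shows False
proof -
  define \<phi> where "\<phi> = (\<lambda>t::real. \<kappa> * t * (a + 2 * cosh t) - 2 * sinh t)"
  \<comment> \<open>the first three derivatives of \<open>\<phi>\<close>\<close>
  define \<phi>1 where "\<phi>1 = (\<lambda>t::real. \<kappa> * (a + 2 * cosh t) + 2 * \<kappa> * t * sinh t - 2 * cosh t)"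
  define \<phi>2 where "\<phi>2 = (\<lambda>t::real. (4 * \<kappa> - 2) * sinh t + 2 * \<kappa> * t * cosh t)"
  define \<phi>3 where "\<phi>3 = (\<lambda>t::real. (6 * \<kappa> - 2) * cosh t + 2 * \<kappa> * t * sinh t)"
  have d0: "(\<phi> has_real_derivative \<phi>1 t) (at t)" for t
    unfolding \<phi>_def \<phi>1_def by (auto intro!: derivative_eq_intros simp: algebra_simps)
  have d1: "(\<phi>1 has_real_derivative \<phi>2 t) (at t)" for t
    unfolding \<phi>1_def \<phi>2_def by (auto intro!: derivative_eq_intros simp: algebra_simps)
  have d2: "(\<phi>2 has_real_derivative \<phi>3 t) (at t)" for t
    unfolding \<phi>2_def \<phi>3_def by (auto intro!: derivative_eq_intros simp: algebra_simps)
  have zeros: "\<phi> 0 = 0" "\<phi> u = 0" "\<phi> v = 0" "\<phi> w = 0"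
    using zero unfolding \<phi>_def by auto
  obtain z1 where z1: "0 < z1" "z1 < u" "\<phi>1 z1 = 0"
    using Rolle_zero[OF d0 \<open>0 < u\<close>] zeros by auto
  obtain z2 where z2: "u < z2" "z2 < v" "\<phi>1 z2 = 0"
    using Rolle_zero[OF d0 \<open>u < v\<close>] zeros by auto
  obtain z3 where z3: "v < z3" "z3 < w" "\<phi>1 z3 = 0"
    using Rolle_zero[OF d0 \<open>v < w\<close>] zeros by auto
  obtain p where p: "z1 < p" "p < z2" "\<phi>2 p = 0"
    using Rolle_zero[OF d1, of z1 z2] z1 z2 by auto
  obtain q where q: "z2 < q" "q < z3" "\<phi>2 q = 0"
    using Rolle_zero[OF d1, of z2 z3] z2 z3 by auto
  have "\<phi>2 0 = 0" unfolding \<phi>2_def by simp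
  then obtain r where r: "0 < r" "r < p" "\<phi>3 r = 0"
    using Rolle_zero[OF d2, of 0 p] z1 p by auto
  obtain s where s: "p < s" "s < q" "\<phi>3 s = 0"
    using Rolle_zero[OF d2, of p q] p q by auto
  have rs: "0 < r" "r < s" "\<phi>3 r = 0" "\<phi>3 s = 0" using r s by auto
  have "2 * \<kappa> * (t * tanh t) = 2 - 6 * \<kappa>" if "\<phi>3 t = 0" for t
    using that cosh_real_pos[of t] unfolding \<phi>3_def tanh_def by (simp add: field_simps)
  then have "2 * \<kappa> * (r * tanh r) = 2 * \<kappa> * (s * tanh s)" using rs by simp
  then have "r * tanh r = s * tanh s" using \<kappa> by simp
  moreover have "r * tanh r < s * tanh s"
    using rs tanh_real_strict_mono by (intro mult_strict_mono) (auto simp: strict_mono_less)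
  ultimately show False by simp
qed

definition free_energy_deriv :: "real \<Rightarrow> real \<Rightarrow> real \<Rightarrow> real" where
  "free_energy_deriv \<beta> K x = 2 * \<beta> * K *
     (x - 2 * sinh (2 * \<beta> * K * x) / (exp \<beta> + 2 * cosh (2 * \<beta> * K * x)))"

lemma exp_plus_cosh_pos: "exp \<beta> + 2 * cosh t > (0::real)"
  using cosh_real_pos[of t] by (simp add: add_pos_pos)

text \<open>Multiplying numerator and denominator by \<open>exp \<beta>\<close> brings out the single parameter \<open>exp \<beta>\<close>
on which all later estimates depend; the critical inverse temperature is where it equals \<open>4\<close>.\<close>

lemma cgf_altdef: "cgf \<beta> t = ln ((exp \<beta> + 2 * cosh t) / (exp \<beta> + 2))"
proof -
  have "(1 + exp (- \<beta>) * (exp t + exp (- t))) / (1 + 2 * exp (- \<beta>)) = (exp \<beta> + 2 * cosh t) / (exp \<beta> + 2)"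
    by (simp add: cosh_def exp_minus divide_simps add_pos_pos) (simp add: algebra_simps)
  then show ?thesis unfolding cgf_def by simp
qed

lemma has_real_derivative_cgf:
  "(cgf \<beta> has_real_derivative 2 * sinh t / (exp \<beta> + 2 * cosh t)) (at t)"
proof -
  have "exp \<beta> + 2 * cosh t \<noteq> 0" for t :: real
    using exp_plus_cosh_pos[of \<beta> t] by linarith
  moreover have "exp \<beta> + 2 \<noteq> 0" using exp_plus_cosh_pos[of \<beta> 0] by simp
  ultimately have "cgf \<beta> = (\<lambda>t. ln (exp \<beta> + 2 * cosh t) - ln (exp \<beta> + 2))"
    by (intro ext) (simp add: cgf_altdef ln_div)
  with exp_plus_cosh_pos[of \<beta> t] show ?thesis
    by (auto intro!: derivative_eq_intros)
qed

lemma has_real_derivative_free_energy: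
  "(free_energy \<beta> K has_real_derivative free_energy_deriv \<beta> K x) (at x)"
  unfolding free_energy_def free_energy_deriv_def
  by (auto intro!: derivative_eq_intros DERIV_chain2[OF has_real_derivative_cgf] simp: algebra_simps)

text \<open>The substitution \<open>t = 2 \<beta> K x\<close> turns the mean-field equation into the equation of
\<open>sinh_cosh_three_zeros\<close>. The bound has to cover every \<open>\<beta> > 0\<close>, because the sequences
may approach the tricritical point from larger \<open>\<beta>\<close>.\<close>

lemma free_energy_deriv_three_zeros:
  assumes "\<beta> > 0" "K > 0" "0 < u" "u < v" "v < w"
    and "free_energy_deriv \<beta> K u = 0" "free_energy_deriv \<beta> K v = 0" "free_energy_deriv \<beta> K w = 0"
  shows False
proof (rule sinh_cosh_three_zeros)
  define l where "l = 2 * \<beta> * K"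
  have l: "l > 0" using assms by (simp add: l_def)
  then show "1 / l > 0" by simp
  show "0 < l * u" "l * u < l * v" "l * v < l * w" using l assms by auto
  fix t assume "t \<in> {l * u, l * v, l * w}"
  then obtain x where t: "t = l * x" and x: "free_energy_deriv \<beta> K x = 0" using assms by blast
  have "l * (x - 2 * sinh t / (exp \<beta> + 2 * cosh t)) = 0"
    using x unfolding free_energy_deriv_def t l_def .
  then have "x = 2 * sinh t / (exp \<beta> + 2 * cosh t)" using l by simp
  then have "x * (exp \<beta> + 2 * cosh t) = 2 * sinh t"
    using exp_plus_cosh_pos[of \<beta> t] by (metis nonzero_eq_divide_eq less_irrefl)
  then show "1 / l * t * (exp \<beta> + 2 * cosh t) = 2 * sinh t" using l t by simp
qed

lemma free_energy_even [simp]: "free_energy \<beta> K (- x) = free_energy \<beta> K x"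
  by (simp add: free_energy_def cgf_altdef)

text \<open>Two positive global minimum points share the same value, so Rolle's theorem would put a third
positive critical point between them.\<close>

lemma positive_global_min_unique:
  assumes "\<beta> > 0" "K > 0" "x > 0" "y > 0"
    and x: "x \<in> global_min_points (free_energy \<beta> K)" and y: "y \<in> global_min_points (free_energy \<beta> K)"
  shows "x = y"
proof -
  have crit: "free_energy_deriv \<beta> K z = 0" if "z \<in> global_min_points (free_energy \<beta> K)" for z
    by (rule DERIV_local_min[OF has_real_derivative_free_energy, of 1])
      (use that in \<open>auto simp: global_min_points_def\<close>)
  have "free_energy \<beta> K x = free_energy \<beta> K y"
    using x y by (auto simp: global_min_points_def intro: order.antisym)
  with Rolle_zero[OF has_real_derivative_free_energy, of _ _ \<beta> K] free_energy_deriv_three_zeros[OF assms(1,2)]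
    crit[OF x] crit[OF y] \<open>x > 0\<close> \<open>y > 0\<close>
  show ?thesis by (metis linorder_less_linear)
qed

lemma thermo_magnetization_global_min:
  assumes "(\<beta>, K) \<in> phase_coexistence"
  shows "thermo_magnetization \<beta> K > 0"
    and "thermo_magnetization \<beta> K \<in> global_min_points (free_energy \<beta> K)"
proof -
  have pos: "\<beta> > 0" "K > 0" using assms by (auto simp: phase_coexistence_def)
  obtain x y where "x \<noteq> y" "x \<in> global_min_points (free_energy \<beta> K)" "y \<in> global_min_points (free_energy \<beta> K)"
    using assms by (auto simp: phase_coexistence_def)
  then obtain z where z: "z \<noteq> 0" "z \<in> global_min_points (free_energy \<beta> K)" by metis
  then have "\<bar>z\<bar> > 0 \<and> \<bar>z\<bar> \<in> global_min_points (free_energy \<beta> K)"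
    by (auto simp: global_min_points_def abs_if)
  then have "\<exists>!x. x > 0 \<and> x \<in> global_min_points (free_energy \<beta> K)"
    using positive_global_min_unique[OF pos] by blast
  from theI'[OF this] show "thermo_magnetization \<beta> K > 0"
    and "thermo_magnetization \<beta> K \<in> global_min_points (free_energy \<beta> K)"
    unfolding thermo_magnetization_def by auto
qed

text \<open>Since \<open>xbar\<close> is the only positive global minimum point of the limit \<open>g\<close>, the values of \<open>g\<close> at
\<open>xbar - d\<close> and \<open>xbar + d\<close> exceed \<open>g xbar\<close>. Pointwise convergence at these three points
already produces a well of the free energy around \<open>xbar / s n\<close>, which by
\<open>global_min_in_well\<close> has to contain the magnetization. This covers the delicate case
\<open>g 0 = g xbar\<close>, in which closeness to \<open>g\<close> alone would let the minimum points escape to \<open>0\<close>.\<close>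

lemma scaled_magnetization_tendsto:
  fixes s :: "nat \<Rightarrow> real"
  assumes coex: "\<forall>\<^sub>F n in sequentially. (\<beta> n, K n) \<in> phase_coexistence"
    and s: "\<forall>\<^sub>F n in sequentially. s n > 0"
    and lim: "\<And>x. (\<lambda>n. real n * free_energy (\<beta> n) (K n) (x / s n)) \<longlonglongrightarrow> g x"
    and min: "{x \<in> global_min_points g. x > 0} = {xbar}"
  shows "(\<lambda>n. s n * thermo_magnetization (\<beta> n) (K n)) \<longlonglongrightarrow> xbar"
proof (rule tendstoI)
  fix \<epsilon> :: real assume "\<epsilon> > 0"
  have xbar: "xbar > 0" "\<And>x. g xbar \<le> g x"
    using min by (auto simp: global_min_points_def)
  have strict: "g xbar < g x" if "x > 0" "x \<noteq> xbar" for x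
  proof -
    have "x \<notin> global_min_points g" using that min by blast
    then obtain y where "g y < g x" by (auto simp: global_min_points_def not_le)
    with xbar(2)[of y] show ?thesis by simp
  qed
  \<comment> \<open>half of \<open>xbar\<close> keeps the left rim of the well positive\<close>
  define d where "d = min (\<epsilon> / 2) (xbar / 2)"
  have d: "0 < d" "d < \<epsilon>" "d < xbar" using \<open>\<epsilon> > 0\<close> xbar(1) by (auto simp: d_def min_def)
  let ?f = "\<lambda>n x. real n * free_energy (\<beta> n) (K n) (x / s n)"
  have ev: "\<forall>\<^sub>F n in sequentially. ?f n xbar < ?f n x" if "x > 0" "x \<noteq> xbar" for x
  proof -
    define c where "c = (g xbar + g x) / 2"
    have "g xbar < c" "c < g x" using strict[OF that] by (auto simp: c_def)
    with lim[of xbar] lim[of x]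
    have "\<forall>\<^sub>F n in sequentially. ?f n xbar < c" "\<forall>\<^sub>F n in sequentially. c < ?f n x"
      by (auto dest: order_tendstoD)
    then show ?thesis by eventually_elim simp
  qed
  have "xbar - d > 0" "xbar + d > 0" "xbar - d \<noteq> xbar" "xbar + d \<noteq> xbar" using d by auto
  from coex s ev[OF this(1,3)] ev[OF this(2,4)] eventually_gt_at_top[of 0]
  show "\<forall>\<^sub>F n in sequentially. dist (s n * thermo_magnetization (\<beta> n) (K n)) xbar < \<epsilon>"
  proof eventually_elim
    case (elim n)
    then have pos: "\<beta> n > 0" "K n > 0" by (auto simp: phase_coexistence_def)
    have "thermo_magnetization (\<beta> n) (K n) \<in> {(xbar - d) / s n .. (xbar + d) / s n}"
    proof (rule global_min_in_well[OF has_real_derivative_free_energy])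
      show False if "0 < u" "u < v" "v < w" "free_energy_deriv (\<beta> n) (K n) u = 0"
        "free_energy_deriv (\<beta> n) (K n) v = 0" "free_energy_deriv (\<beta> n) (K n) w = 0" for u v w
        using free_energy_deriv_three_zeros[OF pos that] .
      show "(xbar - d) / s n > 0" "(xbar - d) / s n < xbar / s n" "xbar / s n < (xbar + d) / s n"
        using d \<open>s n > 0\<close> by (auto simp: divide_strict_right_mono)
      show "free_energy (\<beta> n) (K n) (xbar / s n) < free_energy (\<beta> n) (K n) ((xbar - d) / s n)"
        "free_energy (\<beta> n) (K n) (xbar / s n) < free_energy (\<beta> n) (K n) ((xbar + d) / s n)"
        using elim by auto
    qed (use thermo_magnetization_global_min[OF elim(1)] in \<open>auto simp: global_min_points_def\<close>)
    then have "s n * thermo_magnetization (\<beta> n) (K n) \<in> {xbar - d .. xbar + d}"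
      using \<open>s n > 0\<close> by (auto simp: field_simps)
    then show ?case using d by (auto simp: dist_real_def)
  qed
qed

section \<open>Positivity of the free energy at second-order and tricritical points\<close>

text \<open>The coefficient inequality behind \<open>cosh_less_gaussian\<close>. The constant \<open>6\<close> is \<open>a + 2\<close> at
\<open>a = 4\<close>, that is, at the critical inverse temperature; the inductive step multiplies the
two sides by \<open>6 (k + 1)\<close> and \<open>2 (k + 1) (2 k + 1)\<close>.\<close>

lemma two_times_six_power_le_fact:
  assumes "k \<ge> 1"
  shows "2 * 6 ^ (k - 1) * fact k \<le> (fact (2 * k) :: real)"
  using assms
proof (induction k rule: dec_induct)
  case base
  show ?case by (simp add: numeral_2_eq_2)
next
  case (step k)
  obtain m where k: "k = Suc m" using step by (cases k) auto
  have "2 * 6 ^ (Suc k - 1) * (fact (Suc k) :: real) = (2 * 6 ^ (k - 1) * fact k) * (6 * (real k + 1))"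
    unfolding k by (simp add: algebra_simps)
  also have "\<dots> \<le> fact (2 * k) * ((2 * real k + 1) * (2 * real k + 2))"
  proof (rule mult_mono[OF step.IH])
    have "(real k - 1) * (real k + 1) \<ge> 0" using step by simp
    then show "6 * (real k + 1) \<le> (2 * real k + 1) * (2 * real k + 2)"
      by (simp add: algebra_simps)
  qed auto
  also have "\<dots> = fact (2 * Suc k)" by (simp add: algebra_simps)
  finally show ?case .
qed

lemma cosh_even_series: "(\<lambda>k. t ^ (2 * k) / fact (2 * k)) sums cosh (t::real)"
proof -
  have "strict_mono (\<lambda>k::nat. 2 * k)" by (simp add: strict_mono_def)
  moreover have "(if even n then t ^ n /\<^sub>R fact n else 0) = 0" if "n \<notin> range (\<lambda>k. 2 * k)" for n
    using that by (auto elim!: evenE)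
  ultimately have "(\<lambda>k. if even (2 * k) then t ^ (2 * k) /\<^sub>R fact (2 * k) else 0) sums cosh t"
    using cosh_converges[of t] by (subst sums_mono_reindex)
  then show ?thesis by (simp add: divide_inverse mult.commute)
qed

text \<open>Termwise comparison of power series. The coefficients of order \<open>0\<close> and \<open>2\<close> in \<open>t\<close> agree (this
is what makes \<open>critical_K\<close> critical), and the right-hand coefficients are at least as large from
then on. At \<open>a = 4\<close> those of order \<open>4\<close> agree as well (tricriticality), hence strictness
is read off at order \<open>6\<close>.\<close>

lemma cosh_less_gaussian:
  fixes a t :: real
  assumes "0 < a" "a \<le> 4" "t \<noteq> 0"
  shows "a + 2 * cosh t < (a + 2) * exp (t\<^sup>2 / (a + 2))"
proof -
  define D where "D k = (a + 2) * ((t\<^sup>2 / (a + 2)) ^ k /\<^sub>R fact k)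
      - ((if k = 0 then a else 0) + 2 * (t ^ (2 * k) / fact (2 * k)))" for k
  have D: "D sums ((a + 2) * exp (t\<^sup>2 / (a + 2)) - (a + 2 * cosh t))"
    unfolding D_def
    by (intro sums_diff sums_add sums_mult exp_converges cosh_even_series) (use sums_single[of 0 "\<lambda>_. a"] in simp)
  have D_eq: "D k = t ^ (2 * k) * (1 / ((a + 2) ^ (k - 1) * fact k) - 2 / fact (2 * k))" if "k \<ge> 1" for k
  proof -
    obtain m where k: "k = Suc m" using \<open>k \<ge> 1\<close> by (cases k) auto
    have "(a + 2) * (t\<^sup>2 / (a + 2)) ^ k = t ^ (2 * k) / (a + 2) ^ m"
      using assms unfolding k power_divide power_mult by simp
    then have "D k = t ^ (2 * k) / (a + 2) ^ m / fact k - 2 * (t ^ (2 * k) / fact (2 * k))"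
      unfolding D_def real_scaleR_def mult.left_commute[of "a + 2"] by (simp add: k divide_inverse mult_ac)
    also have "\<dots> = t ^ (2 * k) * (1 / ((a + 2) ^ m * fact k) - 2 / fact (2 * k))"
      by (simp only: right_diff_distrib) (simp add: mult.commute)
    finally show ?thesis by (simp add: k)
  qed
  have le: "2 * ((a + 2) ^ (k - 1) * fact k) \<le> fact (2 * k)" if "k \<ge> 1" for k
  proof -
    have "2 * ((a + 2) ^ (k - 1) * fact k) \<le> 2 * (6 ^ (k - 1) * fact k)"
      using assms by (intro mult_left_mono mult_right_mono power_mono) auto
    also have "\<dots> \<le> fact (2 * k)"
      using two_times_six_power_le_fact[OF that] by (simp only: mult.assoc)
    finally show ?thesis .
  qed
  have nonneg: "D k \<ge> 0" for k
  proof (cases "k = 0")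
    case True
    then show ?thesis by (simp add: D_def)
  next
    case False
    have "2 / fact (2 * k) \<le> 1 / ((a + 2) ^ (k - 1) * fact k)"
      using le[of k] False assms by (intro divide_le_cancel[THEN iffD1] | simp add: field_simps)+
    then show ?thesis using False D_eq[of k] by simp
  qed
  have "D 3 > 0"
  proof -
    have "(a + 2)^2 \<le> 6^2" using assms by (intro power_mono) auto
    then have "2 / 720 < 1 / ((a + 2)\<^sup>2 * 6)"
      using assms by (simp add: field_simps)
    then show ?thesis using D_eq[of 3] assms by (simp add: fact_numeral)
  qed
  with nonneg have "0 < suminf D" by (intro suminf_pos2[where i=3] sums_summable[OF D]) auto
  with sums_unique[OF D] show ?thesis by simp
qed

text \<open>At \<open>K = critical_K \<beta>\<close> the quadratic part of the free energy is \<open>t\<^sup>2 / (exp \<beta> + 2)\<close> in the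
variable \<open>t = 2 \<beta> K x\<close>, exactly the exponent in \<open>cosh_less_gaussian\<close>.\<close>

lemma free_energy_critical_pos:
  assumes "0 < \<beta>" "\<beta> \<le> critical_beta" "x \<noteq> 0"
  shows "free_energy \<beta> (critical_K \<beta>) x > 0"
proof -
  let ?a = "exp \<beta>" and ?t = "2 * \<beta> * critical_K \<beta> * x"
  have a: "?a > 0" "?a \<le> 4"
    using assms(2) by (simp_all add: critical_beta_def ln_ge_iff)
  have K: "4 * \<beta> * critical_K \<beta> = ?a + 2" using assms by (simp add: critical_K_def)
  have a2: "?a + 2 > 0" by (simp add: add_pos_pos)
  have t: "?t = (?a + 2) / 2 * x" using K by simp
  have "?t \<noteq> 0" unfolding t using a2 assms(3) by simp
  have "(?a + 2 * cosh ?t) / (?a + 2) < exp (?t\<^sup>2 / (?a + 2))"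
    using cosh_less_gaussian[OF a \<open>?t \<noteq> 0\<close>] a2 by (simp add: field_simps)
  moreover have "(?a + 2 * cosh ?t) / (?a + 2) > 0" using a2 exp_plus_cosh_pos by simp
  ultimately have "cgf \<beta> ?t < ?t\<^sup>2 / (?a + 2)"
    unfolding cgf_altdef using ln_less_cancel_iff[of _ "exp (?t\<^sup>2 / (?a + 2))"] by (metis exp_gt_zero ln_exp)
  also have "\<dots> = (?a + 2) / 4 * x\<^sup>2" using a2 unfolding t by (simp add: field_simps power2_eq_square)
  also have "\<dots> = \<beta> * critical_K \<beta> * x\<^sup>2" unfolding K[symmetric] by simp
  finally show ?thesis by (simp add: free_energy_def)
qed

text \<open>The spins are bounded by \<open>1\<close>, so the cumulant generating function grows at most linearly and
cannot compete with the quadratic term of the free energy far from the origin.\<close>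

lemma cgf_le_abs: "cgf \<beta> t \<le> \<bar>t\<bar>"
proof -
  have pos: "exp \<beta> + 2 > 0" by (simp add: add_pos_pos)
  have "cosh t \<le> exp \<bar>t\<bar>"
    unfolding cosh_def by (cases "t \<ge> 0") (auto simp: exp_le_cancel_iff)
  moreover have "exp \<beta> \<le> exp \<bar>t\<bar> * exp \<beta>" by simp
  ultimately have "exp \<beta> + 2 * cosh t \<le> exp \<bar>t\<bar> * (exp \<beta> + 2)"
    unfolding distrib_left by linarith
  then have "(exp \<beta> + 2 * cosh t) / (exp \<beta> + 2) \<le> exp \<bar>t\<bar>"
    using pos by (simp only: pos_divide_le_eq)
  moreover have "(exp \<beta> + 2 * cosh t) / (exp \<beta> + 2) > 0" using pos exp_plus_cosh_pos by simp
  ultimately show ?thesis unfolding cgf_altdef using ln_le_cancel_iff by (metis exp_gt_zero ln_exp)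
qed

text \<open>For \<open>R \<le> \<bar>y\<bar> \<le> 4\<close> the bound is inherited from the strictly positive limit functional by compactness,
and for \<open>\<bar>y\<bar> > 4\<close> it follows from the linear bound on the cumulant generating function:
\<open>4\<close> is the point beyond which \<open>2 l \<bar>y\<bar>\<close> is at most half of \<open>l y\<^sup>2\<close>, where \<open>l = \<beta> K\<close>.\<close>

lemma free_energy_quadratic_bound:
  fixes \<beta> K :: "nat \<Rightarrow> real"
  assumes \<beta>0: "0 < \<beta>0" "\<beta>0 \<le> critical_beta"
    and conv: "(\<lambda>n. (\<beta> n, K n)) \<longlonglongrightarrow> (\<beta>0, critical_K \<beta>0)" and "R > 0"
  obtains c where "c > 0"
    "\<forall>\<^sub>F n in sequentially. \<forall>y. R \<le> \<bar>y\<bar> \<longrightarrow> c * y\<^sup>2 \<le> free_energy (\<beta> n) (K n) y"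
proof -
  define K0 where "K0 = critical_K \<beta>0"
  define C where "C = {-4..-R} \<union> {R..4}"
  have C: "compact C" "\<And>y. y \<in> C \<Longrightarrow> y \<noteq> 0" using \<open>R > 0\<close> by (auto simp: C_def)
  define F where "F = (\<lambda>((b, k), y). free_energy b k y / y\<^sup>2)"
  have "1 + exp (- b) * (exp t + exp (- t)) > 0" "1 + 2 * exp (- b) > 0" for b t :: real
    by (auto intro!: add_pos_pos mult_pos_pos)
  then have pos: "1 + exp (- b) * (exp t + exp (- t)) \<noteq> 0" "1 + 2 * exp (- b) \<noteq> 0" for b t :: real
    by (metis less_irrefl)+
  have cont: "continuous_on (UNIV \<times> C) F"
    unfolding F_def free_energy_def cgf_def case_prod_unfold
    by (intro continuous_intros) (use pos C in auto)
  have K0: "\<beta>0 * K0 > 0" using \<beta>0 unfolding K0_def critical_K_def by (simp add: add_pos_pos)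
  obtain c1 where c1: "c1 > 0" "\<And>y. y \<in> C \<Longrightarrow> c1 \<le> F ((\<beta>0, K0), y)"
  proof (cases "C = {}")
    case True
    with that[of 1] show ?thesis by simp
  next
    case False
    have "continuous_on C (\<lambda>y. F ((\<beta>0, K0), y))"
      by (rule continuous_on_compose2[OF cont]) (auto intro!: continuous_intros)
    from continuous_attains_inf[OF C(1) False this]
    obtain z where z: "z \<in> C" "\<And>y. y \<in> C \<Longrightarrow> F ((\<beta>0, K0), z) \<le> F ((\<beta>0, K0), y)" by blast
    have "F ((\<beta>0, K0), z) > 0"
      using free_energy_critical_pos[OF \<beta>0 C(2)[OF z(1)]] C(2)[OF z(1)] by (simp add: F_def K0_def)
    with that z(2) show ?thesis by blast
  qed
  obtain X where X: "(\<beta>0, K0) \<in> X" "open X"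
    "\<forall>p\<in>X \<inter> UNIV. \<forall>y\<in>C. dist (F (p, y)) (F ((\<beta>0, K0), y)) \<le> c1 / 2"
    by (rule continuous_on_prod_compactE[OF cont C(1), of "(\<beta>0, K0)" "c1 / 2"]) (use c1(1) in simp_all)
  have ev1: "\<forall>\<^sub>F n in sequentially. (\<beta> n, K n) \<in> X"
    using topological_tendstoD[OF conv X(2)] X(1) by (simp add: K0_def)
  have "(\<lambda>n. \<beta> n * K n) \<longlonglongrightarrow> \<beta>0 * K0"
    using tendsto_mult[OF tendsto_fst[OF conv] tendsto_snd[OF conv]] by (simp add: K0_def)
  then have ev2: "\<forall>\<^sub>F n in sequentially. \<beta>0 * K0 / 2 < \<beta> n * K n"
    by (rule order_tendstoD(1)) (use K0 in linarith)
  define c where "c = min (c1 / 2) (\<beta>0 * K0 / 4)"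
  have "c > 0" using c1 K0 by (simp add: c_def)
  moreover have "\<forall>\<^sub>F n in sequentially. \<forall>y. R \<le> \<bar>y\<bar> \<longrightarrow> c * y\<^sup>2 \<le> free_energy (\<beta> n) (K n) y"
    using ev1 ev2
  proof eventually_elim
    case (elim n)
    show ?case
    proof (intro allI impI)
      fix y assume y: "R \<le> \<bar>y\<bar>"
      show "c * y\<^sup>2 \<le> free_energy (\<beta> n) (K n) y"
      proof (cases "\<bar>y\<bar> \<le> 4")
        case True
        then have "y \<in> C" using y by (auto simp: C_def abs_if split: if_splits)
        with X(3) elim(1) have "dist (F ((\<beta> n, K n), y)) (F ((\<beta>0, K0), y)) \<le> c1 / 2" by blast
        with c1(2)[OF \<open>y \<in> C\<close>]
        have "c1 / 2 \<le> F ((\<beta> n, K n), y)" by (auto simp: dist_real_def abs_if split: if_splits)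
        moreover have "c \<le> c1 / 2" by (simp add: c_def)
        ultimately have "c \<le> free_energy (\<beta> n) (K n) y / y\<^sup>2" unfolding F_def prod.case by linarith
        then show ?thesis using C(2)[OF \<open>y \<in> C\<close>] by (simp add: pos_le_divide_eq)
      next
        case False
        define l where "l = \<beta> n * K n"
        have l: "l > \<beta>0 * K0 / 2" "l > 0" using elim K0 by (auto simp: l_def)
        have "2 * \<beta> n * K n * y = 2 * l * y" by (simp add: l_def)
        then have "\<bar>2 * \<beta> n * K n * y\<bar> = \<bar>2 * l * y\<bar>" by (rule arg_cong)
        also have "\<dots> = 2 * l * \<bar>y\<bar>" using l by (simp add: abs_mult)
        finally have "\<bar>2 * \<beta> n * K n * y\<bar> = 2 * l * \<bar>y\<bar>" .
        with cgf_le_abs[of "\<beta> n" "2 * \<beta> n * K n * y"]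
        have 1: "free_energy (\<beta> n) (K n) y \<ge> l * y\<^sup>2 - 2 * l * \<bar>y\<bar>"
          by (simp add: free_energy_def l_def)
        have "\<bar>y\<bar> * 4 \<le> \<bar>y\<bar> * \<bar>y\<bar>" using False by (intro mult_left_mono) auto
        then have "l * (\<bar>y\<bar> * 4) \<le> l * y\<^sup>2" using l by (intro mult_left_mono) (auto simp: power2_eq_square)
        with 1 have "free_energy (\<beta> n) (K n) y \<ge> l / 2 * y\<^sup>2" by simp
        moreover have "c * y\<^sup>2 \<le> l / 2 * y\<^sup>2" using l by (intro mult_right_mono) (auto simp: c_def)
        ultimately show ?thesis by simp
      qed
    qed
  qed
  ultimately show ?thesis by (rule that)
qed

section \<open>Gaussian smoothing of the finite-size magnetization\<close>

lemma finite_configs: "finite (configs n)"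
  unfolding configs_def by (intro finite_PiE) auto

lemma partition_function_pos: "partition_function n \<beta> K > 0"
proof -
  have "(\<lambda>j. if j \<in> {1..n} then 0 else undefined) \<in> configs n"
    unfolding configs_def by auto
  then show ?thesis
    unfolding partition_function_def by (intro sum_pos finite_configs) auto
qed

lemma mean_abs_magnetization_eq:
  "mean_abs_magnetization n \<beta> K =
    (\<Sum>\<omega>\<in>configs n. exp (- \<beta> * hamiltonian n K \<omega>) * \<bar>spin_sum n \<omega> / real n\<bar>) / partition_function n \<beta> K"
  unfolding mean_abs_magnetization_def blume_capel_def
proof (subst lebesgue_integral_point_measure_finite[OF finite_configs])
qed (use partition_function_pos[of n \<beta> K] in \<open>auto simp: sum_divide_distrib mult.commute\<close>)

text \<open>Without the interaction the spins are independent, and \<open>exp (cgf \<beta> u)\<close> is the moment generating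
function of one spin; \<open>1 + 2 exp (- \<beta>)\<close> normalizes the law of that spin.\<close>

lemma sum_configs_exp:
  "(\<Sum>\<omega>\<in>configs n. exp (\<Sum>j=1..n. u * \<omega> j - \<beta> * (\<omega> j)\<^sup>2)) = ((1 + 2 * exp (- \<beta>)) * exp (cgf \<beta> u)) ^ n"
proof -
  have pos: "1 + exp (- \<beta>) * (exp u + exp (- u)) > 0" "1 + 2 * exp (- \<beta>) > 0"
    by (auto intro!: add_pos_pos mult_pos_pos)
  have "(\<Sum>\<omega>\<in>configs n. exp (\<Sum>j=1..n. u * \<omega> j - \<beta> * (\<omega> j)\<^sup>2))
      = (\<Sum>\<omega>\<in>PiE {1..n} (\<lambda>_. {1, 0, -1}). \<Prod>j=1..n. exp (u * \<omega> j - \<beta> * (\<omega> j)\<^sup>2))"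
    unfolding configs_def by (simp add: exp_sum)
  also have "\<dots> = (\<Prod>j=1..n. \<Sum>v\<in>{1, 0, -1}. exp (u * v - \<beta> * v\<^sup>2))"
    by (rule prod_sum_PiE[symmetric]) auto
  also have "(\<Sum>v\<in>{1, 0, -1}. exp (u * v - \<beta> * v\<^sup>2)) = 1 + exp (- \<beta>) * (exp u + exp (- u))"
    by (simp add: algebra_simps flip: exp_add)
  also have "\<dots> = (1 + 2 * exp (- \<beta>)) * exp (cgf \<beta> u)"
    unfolding cgf_def using pos by simp
  finally show ?thesis by simp
qed

text \<open>Adding to the magnetization per spin an independent centred Gaussian variable of variance
\<open>1 / (2 n \<beta> K)\<close> gives a density proportional to \<open>exp (- n G)\<close>, where \<open>G\<close> is the free energy.
The reason is that the Gaussian exponent \<open>- n \<beta> K (y - S/n)\<^sup>2\<close> cancels the interaction term \<open>\<beta> K S\<^sup>2 / n\<close>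
of the Boltzmann weight and leaves an exponent linear in the spins, so that the sum over
configurations factorizes.\<close>

lemma hubbard_stratonovich:
  assumes "n > 0" "\<beta> > 0" "K > 0"
  obtains A where "A > 0"
    "\<And>y. (\<Sum>\<omega>\<in>configs n. exp (- \<beta> * hamiltonian n K \<omega>) *
            normal_density (spin_sum n \<omega> / real n) (1 / sqrt (2 * real n * \<beta> * K)) y)
          = A * exp (- real n * free_energy \<beta> K y)"
proof -
  define c where "c = real n * \<beta> * K"
  define \<sigma> where "\<sigma> = 1 / sqrt (2 * real n * \<beta> * K)"
  define B where "B = 1 / sqrt (2 * pi * \<sigma>\<^sup>2)"
  have c: "c > 0" using assms by (simp add: c_def)
  have \<sigma>2: "2 * \<sigma>\<^sup>2 = 1 / c"
    using assms unfolding \<sigma>_def c_def by (simp add: power_divide)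
  have "\<sigma>\<^sup>2 > 0" using \<sigma>2 c by (metis zero_less_divide_1_iff zero_less_mult_iff zero_less_numeral not_numeral_less_zero)
  then have B: "B > 0" unfolding B_def by simp
  \<comment> \<open>completing the square: only a term linear in the total spin survives\<close>
  have *: "exp (- \<beta> * hamiltonian n K \<omega>) * normal_density (spin_sum n \<omega> / real n) \<sigma> y
      = B * exp (- c * y\<^sup>2) * exp (\<Sum>j=1..n. (2 * \<beta> * K * y) * \<omega> j - \<beta> * (\<omega> j)\<^sup>2)" for \<omega> y
  proof -
    define s where "s = spin_sum n \<omega>"
    have "normal_density (s / real n) \<sigma> y = B * exp (- c * (y - s / real n)\<^sup>2)"
      unfolding normal_density_def B_def \<sigma>2 by (simp add: mult.commute)
    moreover have "- \<beta> * hamiltonian n K \<omega> + - c * (y - s / real n)\<^sup>2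
        = - c * y\<^sup>2 + (\<Sum>j=1..n. (2 * \<beta> * K * y) * \<omega> j - \<beta> * (\<omega> j)\<^sup>2)"
    proof -
      define q where "q = (\<Sum>j = 1..n. (\<omega> j)\<^sup>2)"
      have "(\<Sum>j=1..n. (2 * \<beta> * K * y) * \<omega> j - \<beta> * (\<omega> j)\<^sup>2) = 2 * \<beta> * K * y * s - \<beta> * q"
        by (simp add: sum_subtractf sum_distrib_left s_def spin_sum_def q_def)
      moreover have "hamiltonian n K \<omega> = q - K / real n * s\<^sup>2"
        by (simp add: hamiltonian_def s_def spin_sum_def q_def)
      moreover have "- \<beta> * (q - K / real n * s\<^sup>2) + - c * (y - s / real n)\<^sup>2
          = - c * y\<^sup>2 + (2 * \<beta> * K * y * s - \<beta> * q)"
        using assms(1) by (simp add: c_def power2_eq_square field_simps)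
      ultimately show ?thesis by simp
    qed
    ultimately show ?thesis
      by (simp only: s_def[symmetric] mult.left_commute[of _ B] mult.assoc flip: exp_add)
  qed
  show ?thesis
  proof (rule that[of "B * (1 + 2 * exp (- \<beta>)) ^ n"])
    have "1 + 2 * exp (- \<beta>) > 0" by (simp add: add_pos_pos)
    then show "0 < B * (1 + 2 * exp (- \<beta>)) ^ n" using B by simp
    fix y
    have "(\<Sum>\<omega>\<in>configs n. exp (- \<beta> * hamiltonian n K \<omega>) * normal_density (spin_sum n \<omega> / real n) \<sigma> y)
        = B * exp (- c * y\<^sup>2) * ((1 + 2 * exp (- \<beta>)) * exp (cgf \<beta> (2 * \<beta> * K * y))) ^ n"
      by (simp only: * sum_configs_exp flip: sum_distrib_left)
    also have "\<dots> = B * (1 + 2 * exp (- \<beta>)) ^ n * exp (- c * y\<^sup>2 + real n * cgf \<beta> (2 * \<beta> * K * y))"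
      unfolding exp_add power_mult_distrib exp_of_nat_mult by simp
    also have "- c * y\<^sup>2 + real n * cgf \<beta> (2 * \<beta> * K * y) = - real n * free_energy \<beta> K y"
      by (simp add: c_def free_energy_def algebra_simps)
    finally show "(\<Sum>\<omega>\<in>configs n. exp (- \<beta> * hamiltonian n K \<omega>) *
        normal_density (spin_sum n \<omega> / real n) (1 / sqrt (2 * real n * \<beta> * K)) y)
      = B * (1 + 2 * exp (- \<beta>)) ^ n * exp (- real n * free_energy \<beta> K y)"
      unfolding \<sigma>_def .
  qed
qed

lemma normal_density_abs_mean:
  assumes "\<sigma> > 0"
  shows "integrable lborel (\<lambda>y. normal_density \<mu> \<sigma> y * \<bar>y\<bar>)"
    and "\<bar>(LBINT y. normal_density \<mu> \<sigma> y * \<bar>y\<bar>) - \<bar>\<mu>\<bar>\<bar> \<le> \<sigma>"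
proof -
  let ?N = "normal_density \<mu> \<sigma>"
  have int1: "integrable lborel (\<lambda>y. ?N y * \<bar>y - \<mu>\<bar>)"
    using integrable_normal_moment_abs[OF assms, of \<mu> 1] by simp
  have int2: "integrable lborel (\<lambda>y. ?N y * \<bar>\<mu>\<bar>)"
    using integrable_normal_density[OF assms] by simp
  show int: "integrable lborel (\<lambda>y. ?N y * \<bar>y\<bar>)"
  proof (rule Bochner_Integration.integrable_bound[OF Bochner_Integration.integrable_add[OF int1 int2]])
    have "?N y * \<bar>y\<bar> \<le> ?N y * (\<bar>y - \<mu>\<bar> + \<bar>\<mu>\<bar>)" for y by (intro mult_left_mono) auto
    then show "AE y in lborel. norm (?N y * \<bar>y\<bar>) \<le> norm (?N y * \<bar>y - \<mu>\<bar> + ?N y * \<bar>\<mu>\<bar>)"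
      by (simp add: abs_mult distrib_left)
  qed measurable
  have "\<bar>(LBINT y. ?N y * \<bar>y\<bar>) - \<bar>\<mu>\<bar>\<bar> = \<bar>LBINT y. ?N y * \<bar>y\<bar> - ?N y * \<bar>\<mu>\<bar>\<bar>"
    using int int2 assms by simp
  also have "\<dots> \<le> (LBINT y. \<bar>?N y * \<bar>y\<bar> - ?N y * \<bar>\<mu>\<bar>\<bar>)"
    by (rule integral_abs_bound)
  also have "\<dots> \<le> (LBINT y. ?N y * \<bar>y - \<mu>\<bar>)"
  proof (rule integral_mono)
    show "integrable lborel (\<lambda>y. \<bar>?N y * \<bar>y\<bar> - ?N y * \<bar>\<mu>\<bar>\<bar>)" using int int2 by auto
    fix y
    have "\<bar>?N y * \<bar>y\<bar> - ?N y * \<bar>\<mu>\<bar>\<bar> = ?N y * \<bar>\<bar>y\<bar> - \<bar>\<mu>\<bar>\<bar>"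
      by (simp add: abs_mult flip: right_diff_distrib)
    also have "\<dots> \<le> ?N y * \<bar>y - \<mu>\<bar>" by (intro mult_left_mono) auto
    finally show "\<bar>?N y * \<bar>y\<bar> - ?N y * \<bar>\<mu>\<bar>\<bar> \<le> ?N y * \<bar>y - \<mu>\<bar>" .
  qed (rule int1)
  also have "\<dots> = \<sigma> * sqrt (2 / pi)"
    using integral_normal_moment_abs_odd[OF assms, of \<mu> 0] by simp
  also have "\<dots> \<le> \<sigma> * 1"
    using assms pi_ge_two by (intro mult_left_mono) auto
  finally show "\<bar>(LBINT y. ?N y * \<bar>y\<bar>) - \<bar>\<mu>\<bar>\<bar> \<le> \<sigma>" by simp
qed

text \<open>The quotient is the mean absolute value of the smoothed magnetization, and the smoothing moves it by
at most the mean absolute value of the Gaussian, which is at most its standard deviation.\<close>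

lemma mean_abs_magnetization_smoothed:
  assumes "n > 0" "\<beta> > 0" "K > 0"
  shows "\<bar>mean_abs_magnetization n \<beta> K
      - (LBINT y. \<bar>y\<bar> * exp (- real n * free_energy \<beta> K y)) / (LBINT y. exp (- real n * free_energy \<beta> K y))\<bar>
    \<le> 1 / sqrt (2 * real n * \<beta> * K)"
proof -
  define \<sigma> where "\<sigma> = 1 / sqrt (2 * real n * \<beta> * K)"
  have \<sigma>: "\<sigma> > 0" using assms by (simp add: \<sigma>_def)
  define w where "w = (\<lambda>\<omega>. exp (- \<beta> * hamiltonian n K \<omega>))"
  define N where "N = (\<lambda>\<omega>. normal_density (spin_sum n \<omega> / real n) \<sigma>)"
  define Z where "Z = partition_function n \<beta> K"
  define E where "E = (\<lambda>y. exp (- real n * free_energy \<beta> K y))"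
  obtain A where A: "A > 0" "\<And>y. (\<Sum>\<omega>\<in>configs n. w \<omega> * N \<omega> y) = A * E y"
    using hubbard_stratonovich[OF assms] unfolding w_def N_def E_def \<sigma>_def by blast
  have Z: "Z > 0" "Z = (\<Sum>\<omega>\<in>configs n. w \<omega>)"
    unfolding Z_def w_def partition_function_def[symmetric] by (simp_all add: partition_function_pos)
  have "A * (LBINT y. E y) = (LBINT y. \<Sum>\<omega>\<in>configs n. w \<omega> * N \<omega> y)"
    unfolding A(2) by simp
  also have "\<dots> = (\<Sum>\<omega>\<in>configs n. w \<omega>)"
    using \<sigma> by (simp add: N_def Bochner_Integration.integral_sum)
  finally have E0: "A * (LBINT y. E y) = Z" unfolding Z(2) .
  have "A * (LBINT y. \<bar>y\<bar> * E y) = (LBINT y. (\<Sum>\<omega>\<in>configs n. w \<omega> * N \<omega> y) * \<bar>y\<bar>)"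
    unfolding A(2) by (simp add: mult_ac)
  also have "\<dots> = (LBINT y. (\<Sum>\<omega>\<in>configs n. w \<omega> * (N \<omega> y * \<bar>y\<bar>)))"
    by (simp only: sum_distrib_right mult.assoc)
  also have "\<dots> = (\<Sum>\<omega>\<in>configs n. w \<omega> * (LBINT y. N \<omega> y * \<bar>y\<bar>))"
    using normal_density_abs_mean(1)[OF \<sigma>] by (simp add: N_def Bochner_Integration.integral_sum)
  finally have E1: "A * (LBINT y. \<bar>y\<bar> * E y) = (\<Sum>\<omega>\<in>configs n. w \<omega> * (LBINT y. N \<omega> y * \<bar>y\<bar>))" .
  have "(LBINT y. \<bar>y\<bar> * E y) / (LBINT y. E y) = (A * (LBINT y. \<bar>y\<bar> * E y)) / (A * (LBINT y. E y))"
    using A(1) by simp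
  also have "\<dots> = (\<Sum>\<omega>\<in>configs n. w \<omega> * (LBINT y. N \<omega> y * \<bar>y\<bar>)) / Z" unfolding E0 E1 ..
  finally have ratio: "(LBINT y. \<bar>y\<bar> * E y) / (LBINT y. E y) = \<dots>" .
  have "\<bar>mean_abs_magnetization n \<beta> K - (LBINT y. \<bar>y\<bar> * E y) / (LBINT y. E y)\<bar>
      = \<bar>\<Sum>\<omega>\<in>configs n. w \<omega> * (\<bar>spin_sum n \<omega> / real n\<bar> - (LBINT y. N \<omega> y * \<bar>y\<bar>))\<bar> / Z"
    unfolding ratio mean_abs_magnetization_eq using Z(1)
    by (simp add: Z_def w_def abs_divide right_diff_distrib sum_subtractf flip: diff_divide_distrib)
  also have "\<dots> \<le> (\<Sum>\<omega>\<in>configs n. w \<omega> * \<sigma>) / Z"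
  proof (rule divide_right_mono[OF order.trans[OF sum_abs sum_mono]])
    fix \<omega>
    show "\<bar>w \<omega> * (\<bar>spin_sum n \<omega> / real n\<bar> - (LBINT y. N \<omega> y * \<bar>y\<bar>))\<bar> \<le> w \<omega> * \<sigma>"
      using normal_density_abs_mean(2)[OF \<sigma>, of "spin_sum n \<omega> / real n"]
      unfolding abs_mult N_def by (simp add: w_def abs_minus_commute)
  qed (use Z in simp)
  also have "\<dots> = \<sigma>" using Z(1) by (simp add: Z(2) flip: sum_distrib_right)
  finally show ?thesis unfolding E_def \<sigma>_def .
qed

section \<open>Limits of the rescaled integrals\<close>

text \<open>Write \<open>H x = a + x q x\<close>. The factor \<open>q\<close> is not constant, because a polynomial of degree at most
one does not tend to infinity in both directions; hence \<open>\<bar>q x\<bar> \<ge> 1\<close> eventually, and \<open>x q x\<close>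
is eventually nonnegative.\<close>

lemma poly_at_top_linear_lower_bound:
  fixes H :: "real poly"
  assumes lim: "filterlim (poly H) at_top at_infinity"
  obtains C where "\<And>x. \<bar>x\<bar> - C \<le> poly H x"
proof -
  obtain a q where H: "H = pCons a q" by (cases H) auto
  have "degree q > 0"
  proof (rule ccontr)
    assume "\<not> degree q > 0"
    then obtain d where q: "q = [:d:]" by (metis degree_eq_zeroE gr_zeroI)
    have "\<forall>\<^sub>F x in at_infinity. a + 1 \<le> poly H x"
      using lim unfolding filterlim_at_top by blast
    then obtain B where B: "\<And>x. B \<le> \<bar>x\<bar> \<Longrightarrow> 1 \<le> x * d"
      unfolding eventually_at_infinity H q by auto
    from B[of "\<bar>B\<bar>"] B[of "- \<bar>B\<bar>"] show False by (simp add: abs_ge_self)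
  qed
  then have "filterlim (poly q) at_infinity at_infinity" by (rule filterlim_poly_at_infinity)
  then have "\<forall>r>0. \<forall>\<^sub>F x in at_infinity. r \<le> norm (poly q x)"
    unfolding filterlim_at_infinity[OF order_refl] .
  from this[rule_format, of 1] have "\<forall>\<^sub>F x in at_infinity. 1 \<le> \<bar>poly q x\<bar>"
    by simp
  moreover have "\<forall>\<^sub>F x in at_infinity. a \<le> poly H x"
    using lim unfolding filterlim_at_top by blast
  ultimately have "\<forall>\<^sub>F x in at_infinity. \<bar>x\<bar> + a \<le> poly H x"
  proof eventually_elim
    case (elim x)
    then have "0 \<le> x * poly q x" by (simp add: H)
    then have "x * poly q x = \<bar>x\<bar> * \<bar>poly q x\<bar>" by (metis abs_mult abs_of_nonneg)
    moreover have "\<bar>x\<bar> * 1 \<le> \<bar>x\<bar> * \<bar>poly q x\<bar>" using elim by (intro mult_left_mono) auto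
    ultimately show ?case by (simp add: H)
  qed
  then obtain B where B: "\<And>x. B \<le> \<bar>x\<bar> \<Longrightarrow> \<bar>x\<bar> + a \<le> poly H x"
    unfolding eventually_at_infinity by auto
  have "compact ((\<lambda>x. \<bar>x\<bar> - poly H x) ` {-B..B})"
    by (intro compact_continuous_image continuous_intros) auto
  then have "bdd_above ((\<lambda>x. \<bar>x\<bar> - poly H x) ` {-B..B})"
    by (intro bounded_imp_bdd_above compact_imp_bounded)
  then obtain M where M: "\<And>x. x \<in> {-B..B} \<Longrightarrow> \<bar>x\<bar> - poly H x \<le> M"
    unfolding bdd_above_def by blast
  show ?thesis
  proof (rule that[of "max M (- a)"])
    fix x show "\<bar>x\<bar> - max M (- a) \<le> poly H x"
    proof (cases "B \<le> \<bar>x\<bar>")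
      case True
      with B[of x] show ?thesis by linarith
    next
      case False
      then have "x \<in> {-B..B}" by auto
      with M[of x] show ?thesis by linarith
    qed
  qed
qed

lemma integrable_abs_power_exp_abs: "integrable lborel (\<lambda>x::real. \<bar>x\<bar> ^ k * exp (- \<bar>x\<bar>))"
proof -
  have "has_bochner_integral lborel (\<lambda>x::real. indicator {0..} x *\<^sub>R (\<bar>x\<bar> ^ k * exp (- \<bar>x\<bar>))) (fact k)"
    by (rule has_bochner_integral_cong[THEN iffD1, OF _ _ _ has_bochner_integral_I0i_power_exp_m'[of k]])
      (auto split: split_indicator)
  from has_bochner_integral_even_function[OF this] show ?thesis
    by (auto simp: has_bochner_integral_iff)
qed

text \<open>Dominated convergence with the majorant \<open>exp C \<bar>x\<bar>^k exp (- \<bar>x\<bar>)\<close>. Only the exponents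
\<open>k = 0\<close> (normalization) and \<open>k = 1\<close> (mean absolute value) matter below.\<close>

lemma Laplace_limit:
  fixes f :: "nat \<Rightarrow> real \<Rightarrow> real"
  assumes [measurable]: "\<And>n. f n \<in> borel_measurable borel" "g \<in> borel_measurable borel"
    and lim: "\<And>x. (\<lambda>n. f n x) \<longlonglongrightarrow> g x"
    and bound: "\<forall>\<^sub>F n in sequentially. \<forall>x. \<bar>x\<bar> - C \<le> f n x"
  shows "integrable lborel (\<lambda>x. \<bar>x\<bar> ^ k * exp (- g x))"
    and "(\<lambda>n. LBINT x. \<bar>x\<bar> ^ k * exp (- f n x)) \<longlonglongrightarrow> (LBINT x. \<bar>x\<bar> ^ k * exp (- g x))"
proof -
  obtain N where N: "\<And>n x. n \<ge> N \<Longrightarrow> \<bar>x\<bar> - C \<le> f n x"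
    using bound by (auto simp: eventually_sequentially)
  define w where "w = (\<lambda>x::real. exp C * (\<bar>x\<bar> ^ k * exp (- \<bar>x\<bar>)))"
  have w: "integrable lborel w"
    unfolding w_def using integrable_abs_power_exp_abs by simp
  have lim': "AE x in lborel. (\<lambda>n. \<bar>x\<bar> ^ k * exp (- f (n + N) x)) \<longlonglongrightarrow> \<bar>x\<bar> ^ k * exp (- g x)"
    by (intro AE_I2 tendsto_intros LIMSEQ_ignore_initial_segment[OF lim])
  have dom: "AE x in lborel. norm (\<bar>x\<bar> ^ k * exp (- f (n + N) x)) \<le> w x" for n
  proof (rule AE_I2)
    fix x :: real
    have "exp (- f (n + N) x) \<le> exp (C - \<bar>x\<bar>)" using N[of "n + N" x] by simp
    then have "\<bar>x\<bar> ^ k * exp (- f (n + N) x) \<le> \<bar>x\<bar> ^ k * exp (C - \<bar>x\<bar>)"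
      by (rule mult_left_mono) simp
    then show "norm (\<bar>x\<bar> ^ k * exp (- f (n + N) x)) \<le> w x"
      by (simp add: w_def exp_diff exp_minus divide_inverse mult_ac)
  qed
  show "integrable lborel (\<lambda>x. \<bar>x\<bar> ^ k * exp (- g x))"
    by (rule integrable_dominated_convergence[OF _ _ w lim' dom]) measurable
  have "(\<lambda>n. LBINT x. \<bar>x\<bar> ^ k * exp (- f (n + N) x)) \<longlonglongrightarrow> (LBINT x. \<bar>x\<bar> ^ k * exp (- g x))"
    by (rule integral_dominated_convergence[OF _ _ w lim' dom]) measurable
  then show "(\<lambda>n. LBINT x. \<bar>x\<bar> ^ k * exp (- f n x)) \<longlonglongrightarrow> (LBINT x. \<bar>x\<bar> ^ k * exp (- g x))"
    by (rule LIMSEQ_offset)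
qed

lemma integral_abs_power_exp_pos:
  fixes g :: "real \<Rightarrow> real"
  assumes "integrable lborel (\<lambda>x. \<bar>x\<bar> ^ k * exp (- g x))"
  shows "(LBINT x. \<bar>x\<bar> ^ k * exp (- g x)) > 0"
proof -
  have "(LBINT x. \<bar>x\<bar> ^ k * exp (- g x)) \<noteq> 0"
  proof
    assume "(LBINT x. \<bar>x\<bar> ^ k * exp (- g x)) = 0"
    then have "AE x in lborel. \<bar>x\<bar> ^ k * exp (- g x) = 0"
      using integral_nonneg_eq_0_iff_AE[OF assms] by simp
    with AE_lborel_singleton[of "0::real"] have "AE x in (lborel :: real measure). False"
      by eventually_elim simp
    then show False by (simp add: eventually_False ae_filter_eq_bot_iff)
  qed
  moreover have "(LBINT x. \<bar>x\<bar> ^ k * exp (- g x)) \<ge> 0" by simp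
  ultimately show ?thesis by linarith
qed

lemma LBINT_abs_power_rescale:
  fixes F :: "real \<Rightarrow> real"
  assumes "s > 0"
  shows "(LBINT y. \<bar>y\<bar> ^ k * exp (- F y)) = (LBINT x. \<bar>x\<bar> ^ k * exp (- F (x / s))) / s ^ Suc k"
proof -
  have "(LBINT y. \<bar>y\<bar> ^ k * exp (- F y)) = (1 / s) * (LBINT x. \<bar>x / s\<bar> ^ k * exp (- F (x / s)))"
    using lborel_integral_real_affine[of "1 / s" "\<lambda>y. \<bar>y\<bar> ^ k * exp (- F y)" 0] assms by simp
  also have "(\<lambda>x. \<bar>x / s\<bar> ^ k * exp (- F (x / s))) = (\<lambda>x. (\<bar>x\<bar> ^ k * exp (- F (x / s))) * (1 / s ^ k))"
    using assms by (auto simp: abs_divide power_divide)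
  finally show ?thesis by simp
qed

text \<open>This provides the domination for \<open>Laplace_limit\<close>. For \<open>\<bar>x / s n\<bar> < R\<close> it comes from the polynomial \<open>H\<close>.
Elsewhere the quadratic lower bound on the free energy gives \<open>n c (x / s n)\<^sup>2 \<ge> c x\<^sup>2\<close>, since
\<open>(s n)\<^sup>2 \<le> n\<close>, and a parabola dominates \<open>\<bar>x\<bar>\<close> up to the constant \<open>1 / (4 c)\<close>.\<close>

lemma free_energy_linear_lower_bound:
  fixes \<beta> K s :: "nat \<Rightarrow> real" and H :: "real poly"
  assumes \<beta>0: "0 < \<beta>0" "\<beta>0 \<le> critical_beta"
    and conv: "(\<lambda>n. (\<beta> n, K n)) \<longlonglongrightarrow> (\<beta>0, critical_K \<beta>0)"
    and s: "\<forall>\<^sub>F n in sequentially. 0 < s n \<and> (s n)\<^sup>2 \<le> real n"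
    and H: "filterlim (poly H) at_top at_infinity"
    and R: "R > 0" "\<forall>\<^sub>F n in sequentially. \<forall>x. \<bar>x / s n\<bar> < R \<longrightarrow>
       poly H x \<le> real n * free_energy (\<beta> n) (K n) (x / s n)"
  obtains C where "\<forall>\<^sub>F n in sequentially. \<forall>x. \<bar>x\<bar> - C \<le> real n * free_energy (\<beta> n) (K n) (x / s n)"
proof -
  obtain C where C: "\<And>x. \<bar>x\<bar> - C \<le> poly H x" using poly_at_top_linear_lower_bound[OF H] by blast
  obtain c where c: "c > 0" "\<forall>\<^sub>F n in sequentially. \<forall>y. R \<le> \<bar>y\<bar> \<longrightarrow> c * y\<^sup>2 \<le> free_energy (\<beta> n) (K n) y"
    by (rule free_energy_quadratic_bound[OF \<beta>0 conv R(1)])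
  have "\<forall>\<^sub>F n in sequentially. \<forall>x. \<bar>x\<bar> - max C (1 / (4 * c)) \<le> real n * free_energy (\<beta> n) (K n) (x / s n)"
    using s R(2) c(2)
  proof eventually_elim
    case (elim n)
    show ?case
    proof
      fix x
      show "\<bar>x\<bar> - max C (1 / (4 * c)) \<le> real n * free_energy (\<beta> n) (K n) (x / s n)"
      proof (cases "\<bar>x / s n\<bar> < R")
        case True
        with elim C[of x] show ?thesis by (metis diff_left_mono max.cobounded1 order.trans)
      next
        case False
        have "0 \<le> (2 * c * \<bar>x\<bar> - 1)\<^sup>2" by simp
        then have "4 * c * \<bar>x\<bar> - 1 \<le> 4 * c * (c * x\<^sup>2)" by (simp add: power2_eq_square algebra_simps)
        then have "\<bar>x\<bar> - 1 / (4 * c) \<le> c * x\<^sup>2" using c(1) by (simp add: field_simps)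
        also have "c * x\<^sup>2 = (s n)\<^sup>2 * (c * (x / s n)\<^sup>2)" using elim by (simp add: power_divide)
        also have "\<dots> \<le> real n * (c * (x / s n)\<^sup>2)" using elim c(1) by (intro mult_right_mono) auto
        also have "\<dots> \<le> real n * free_energy (\<beta> n) (K n) (x / s n)"
          using elim False by (intro mult_left_mono) auto
        finally show ?thesis by linarith
      qed
    qed
  qed
  then show ?thesis by (rule that)
qed

text \<open>The substitution \<open>y = x / s\<close> in \<open>mean_abs_magnetization_smoothed\<close>.\<close>

lemma mean_abs_magnetization_rescaled_bound:
  assumes "n > 0" "\<beta> > 0" "K > 0" "s > 0"
  defines "f \<equiv> \<lambda>x. real n * free_energy \<beta> K (x / s)"
  shows "\<bar>s * mean_abs_magnetization n \<beta> K - (LBINT x. \<bar>x\<bar> * exp (- f x)) / (LBINT x. exp (- f x))\<bar>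
    \<le> s / sqrt (2 * real n * \<beta> * K)"
proof -
  define I where "I = (LBINT x. \<bar>x\<bar> * exp (- f x)) / (LBINT x. exp (- f x))"
  have "(LBINT y. \<bar>y\<bar> * exp (- real n * free_energy \<beta> K y)) / (LBINT y. exp (- real n * free_energy \<beta> K y)) = I / s"
    using LBINT_abs_power_rescale[OF \<open>s > 0\<close>, of 1 "\<lambda>y. real n * free_energy \<beta> K y"]
      LBINT_abs_power_rescale[OF \<open>s > 0\<close>, of 0 "\<lambda>y. real n * free_energy \<beta> K y"] \<open>s > 0\<close>
    by (simp add: I_def f_def power2_eq_square)
  with mean_abs_magnetization_smoothed[OF assms(1-3)]
  have "\<bar>mean_abs_magnetization n \<beta> K - I / s\<bar> \<le> 1 / sqrt (2 * real n * \<beta> * K)" by simp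
  then have "s * \<bar>mean_abs_magnetization n \<beta> K - I / s\<bar> \<le> s * (1 / sqrt (2 * real n * \<beta> * K))"
    using \<open>s > 0\<close> by (intro mult_left_mono) auto
  moreover have "s * \<bar>mean_abs_magnetization n \<beta> K - I / s\<bar> = \<bar>s * (mean_abs_magnetization n \<beta> K - I / s)\<bar>"
    using \<open>s > 0\<close> by (simp add: abs_mult)
  ultimately show ?thesis using \<open>s > 0\<close> by (simp add: I_def right_diff_distrib)
qed

text \<open>The quotient of rescaled integrals converges to \<open>zbar\<close> by \<open>Laplace_limit\<close>, and the Gaussian smoothing
costs \<open>s n / sqrt (2 n \<beta> K)\<close>, which vanishes precisely because \<open>s n\<close> grows more slowly than
\<open>sqrt n\<close>.\<close>

lemma scaled_mean_abs_magnetization_tendsto: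
  fixes \<beta> K s :: "nat \<Rightarrow> real" and g :: "real \<Rightarrow> real"
  assumes pos: "\<forall>\<^sub>F n in sequentially. \<beta> n > 0 \<and> K n > 0 \<and> s n > 0"
    and conv: "(\<lambda>n. \<beta> n * K n) \<longlonglongrightarrow> l" "l > 0"
    and s: "(\<lambda>n. s n / sqrt (real n)) \<longlonglongrightarrow> 0"
    and g: "g \<in> borel_measurable borel"
    and lim: "\<And>x. (\<lambda>n. real n * free_energy (\<beta> n) (K n) (x / s n)) \<longlonglongrightarrow> g x"
    and bound: "\<forall>\<^sub>F n in sequentially. \<forall>x. \<bar>x\<bar> - C \<le> real n * free_energy (\<beta> n) (K n) (x / s n)"
  defines "zbar \<equiv> (LBINT x. \<bar>x\<bar> * exp (- g x)) / (LBINT x. exp (- g x))"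
  shows "(\<lambda>n. s n * mean_abs_magnetization n (\<beta> n) (K n)) \<longlonglongrightarrow> zbar" and "zbar > 0"
proof -
  define f where "f = (\<lambda>n x. real n * free_energy (\<beta> n) (K n) (x / s n))"
  define I where "I n = (LBINT x. \<bar>x\<bar> * exp (- f n x)) / (LBINT x. exp (- f n x))" for n
  have meas: "f n \<in> borel_measurable borel" for n
    unfolding f_def free_energy_def cgf_def by measurable
  have f_lim: "(\<lambda>n. f n x) \<longlonglongrightarrow> g x" for x using lim by (simp add: f_def)
  have f_bound: "\<forall>\<^sub>F n in sequentially. \<forall>x. \<bar>x\<bar> - C \<le> f n x" using bound by (simp add: f_def)
  note Laplace = Laplace_limit[where f = f and g = g, OF meas g f_lim f_bound]
  have J: "(LBINT x. exp (- g x)) > 0" "(LBINT x. \<bar>x\<bar> * exp (- g x)) > 0"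
    using integral_abs_power_exp_pos[OF Laplace(1)[of 0]] integral_abs_power_exp_pos[OF Laplace(1)[of 1]]
    by simp_all
  then show "zbar > 0" by (simp add: zbar_def)
  have I: "I \<longlonglongrightarrow> zbar"
    unfolding I_def zbar_def using Laplace(2)[of 0] Laplace(2)[of 1] J(1) by (intro tendsto_divide) auto
  have "(\<lambda>n. (s n / sqrt (real n)) / sqrt (2 * (\<beta> n * K n))) \<longlonglongrightarrow> 0 / sqrt (2 * l)"
    using conv s by (intro tendsto_intros) auto
  then have err: "(\<lambda>n. s n / sqrt (2 * real n * \<beta> n * K n)) \<longlonglongrightarrow> 0"
    by (simp add: real_sqrt_mult mult_ac)
  have "(\<lambda>n. s n * mean_abs_magnetization n (\<beta> n) (K n) - I n) \<longlonglongrightarrow> 0"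
  proof (rule Lim_null_comparison[OF _ err])
    show "\<forall>\<^sub>F n in sequentially. norm (s n * mean_abs_magnetization n (\<beta> n) (K n) - I n)
        \<le> s n / sqrt (2 * real n * \<beta> n * K n)"
      using pos eventually_gt_at_top[of 0]
    proof eventually_elim
      case (elim n)
      then show ?case
        unfolding I_def f_def real_norm_def by (intro mean_abs_magnetization_rescaled_bound) auto
    qed
  qed
  from tendsto_add[OF this I] show "(\<lambda>n. s n * mean_abs_magnetization n (\<beta> n) (K n)) \<longlonglongrightarrow> zbar"
    by simp
qed

section \<open>Asymptotics of the finite-size magnetization\<close>

theorem theorem4p3:
  fixes \<beta> \<alpha>0 \<theta> xbar zbar :: real
    and \<beta>s Ks :: "real \<Rightarrow> nat \<Rightarrow> real"
    and b k :: "real \<Rightarrow> real"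
    and g H :: "real poly"
  assumes beta: "0 < \<beta>" "\<beta> \<le> critical_beta"
    and pos: "\<And>\<alpha> n. \<alpha> > 0 \<Longrightarrow> n \<ge> 1 \<Longrightarrow> \<beta>s \<alpha> n > 0 \<and> Ks \<alpha> n > 0"
    and conv: "\<And>\<alpha>. \<alpha> > 0 \<Longrightarrow> (\<lambda>n. (\<beta>s \<alpha> n, Ks \<alpha> n)) \<longlonglongrightarrow> (\<beta>, critical_K \<beta>)"
    and hyp_i: "\<And>\<alpha>. \<alpha> > 0 \<Longrightarrow> \<forall>\<^sub>F n in sequentially. (\<beta>s \<alpha> n, Ks \<alpha> n) \<in> phase_coexistence"
    and hyp_ii_b: "\<And>\<alpha>. \<alpha> > 0 \<Longrightarrow> (\<lambda>n. real n powr \<alpha> * (\<beta>s \<alpha> n - \<beta>)) \<longlonglongrightarrow> b \<alpha>"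
    and hyp_ii_k: "\<And>\<alpha>. \<alpha> > 0 \<Longrightarrow> (\<lambda>n. real n powr \<alpha> * (Ks \<alpha> n - critical_K \<beta>)) \<longlonglongrightarrow> k \<alpha>"
    and hyp_ii_nz: "\<And>\<alpha>. \<alpha> > 0 \<Longrightarrow> \<not> (b \<alpha> = 0 \<and> k \<alpha> = 0)"
    and hyp_ii_pm: "\<And>\<alpha>. \<alpha> > 0 \<Longrightarrow> b \<alpha> \<noteq> 0 \<Longrightarrow> b \<alpha> \<in> {1, -1}"
    and g_even: "\<And>x. poly g (- x) = poly g x"
    and g_degree: "degree g = 4 \<or> degree g = 6"
    and g_infinity: "filterlim (poly g) at_top at_infinity"
    and alpha0: "\<alpha>0 > 0"
    and theta: "\<theta> > 0"
    and hyp_iii_a: "\<And>C. compact C \<Longrightarrow>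
      uniform_limit C
        (\<lambda>n x. real n * free_energy (\<beta>s \<alpha>0 n) (Ks \<alpha>0 n) (x / real n powr (\<theta> * \<alpha>0)))
        (poly g) sequentially"
    and hyp_iii_b: "{x \<in> global_min_points (poly g). x > 0} = {xbar}"
    and H_infinity: "filterlim (poly H) at_top at_infinity"
    and hyp_iv: "\<exists>R>0. \<forall>\<^sub>F n in sequentially. \<forall>x. \<bar>x / real n powr (\<theta> * \<alpha>0)\<bar> < R \<longrightarrow>
      real n * free_energy (\<beta>s \<alpha>0 n) (Ks \<alpha>0 n) (x / real n powr (\<theta> * \<alpha>0)) \<ge> poly H x"
    and exponent: "0 < \<theta> * \<alpha>0" "\<theta> * \<alpha>0 < 1 / 2"
    and zbar: "zbar = 1 / (LBINT x. exp (- poly g x)) * (LBINT x. \<bar>x\<bar> * exp (- poly g x))"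
  shows "((\<lambda>n. mean_abs_magnetization n (\<beta>s \<alpha>0 n) (Ks \<alpha>0 n))
            \<sim>[sequentially] (\<lambda>n. zbar / real n powr (\<theta> * \<alpha>0))
        \<and> (\<lambda>n. real n powr (\<theta> * \<alpha>0) * mean_abs_magnetization n (\<beta>s \<alpha>0 n) (Ks \<alpha>0 n))
            \<longlonglongrightarrow> zbar)
    \<and> (\<lambda>n. mean_abs_magnetization n (\<beta>s \<alpha>0 n) (Ks \<alpha>0 n))
        \<sim>[sequentially] (\<lambda>n. zbar * thermo_magnetization (\<beta>s \<alpha>0 n) (Ks \<alpha>0 n) / xbar)"
proof -
  define \<gamma> where "\<gamma> = \<theta> * \<alpha>0"
  define s where "s = (\<lambda>n. real n powr \<gamma>)"
  define B where "B = \<beta>s \<alpha>0"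
  define K where "K = Ks \<alpha>0"
  define M where "M = (\<lambda>n. mean_abs_magnetization n (B n) (K n))"
  define m where "m = (\<lambda>n. thermo_magnetization (B n) (K n))"
  have \<gamma>: "0 < \<gamma>" "\<gamma> < 1 / 2" using exponent by (auto simp: \<gamma>_def)
  have BK: "B n > 0" "K n > 0" if "n \<ge> 1" for n
    using pos[OF alpha0 that] by (auto simp: B_def K_def)
  have s_pos: "\<forall>\<^sub>F n in sequentially. s n > 0"
    using eventually_gt_at_top[of 0] by eventually_elim (simp add: s_def)
  have BK_lim: "(\<lambda>n. (B n, K n)) \<longlonglongrightarrow> (\<beta>, critical_K \<beta>)"
    using conv[OF alpha0] by (simp add: B_def K_def)
  have lim: "(\<lambda>n. real n * free_energy (B n) (K n) (x / s n)) \<longlonglongrightarrow> poly g x" for x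
    using tendsto_uniform_limitI[OF hyp_iii_a[of "{x}"]] by (simp add: B_def K_def s_def \<gamma>_def)
  have s_sq: "\<forall>\<^sub>F n in sequentially. 0 < s n \<and> (s n)\<^sup>2 \<le> real n"
    using eventually_ge_at_top[of 1]
  proof eventually_elim
    case (elim n)
    have "real n powr (2 * \<gamma>) \<le> real n powr 1" using elim \<gamma> by (intro powr_mono) auto
    with elim show ?case by (simp add: s_def powr_power)
  qed
  obtain R where R: "R > 0" "\<forall>\<^sub>F n in sequentially. \<forall>x. \<bar>x / s n\<bar> < R \<longrightarrow>
      poly H x \<le> real n * free_energy (B n) (K n) (x / s n)"
    using hyp_iv unfolding s_def B_def K_def \<gamma>_def by blast
  obtain C where C: "\<forall>\<^sub>F n in sequentially. \<forall>x. \<bar>x\<bar> - C \<le> real n * free_energy (B n) (K n) (x / s n)"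
    using free_energy_linear_lower_bound[OF beta BK_lim s_sq H_infinity R] by blast
  have pos': "\<forall>\<^sub>F n in sequentially. B n > 0 \<and> K n > 0 \<and> s n > 0"
    using s_pos eventually_ge_at_top[of 1] by eventually_elim (simp add: BK)
  have BK_prod: "(\<lambda>n. B n * K n) \<longlonglongrightarrow> \<beta> * critical_K \<beta>"
    using tendsto_mult[OF tendsto_fst[OF BK_lim] tendsto_snd[OF BK_lim]] by simp
  have bK_pos: "\<beta> * critical_K \<beta> > 0"
    using beta by (simp add: critical_K_def add_pos_pos)
  have s_small: "(\<lambda>n. s n / sqrt (real n)) \<longlonglongrightarrow> 0"
  proof -
    have "(\<lambda>n. real n powr (\<gamma> - 1 / 2)) \<longlonglongrightarrow> 0"
      by (rule tendsto_neg_powr[OF _ filterlim_real_sequentially]) (use \<gamma> in simp)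
    then show ?thesis by (simp add: s_def powr_diff powr_half_sqrt)
  qed
  have zbar': "zbar = (LBINT x. \<bar>x\<bar> * exp (- poly g x)) / (LBINT x. exp (- poly g x))"
    unfolding zbar by simp
  have meas: "poly g \<in> borel_measurable borel"
    by (intro borel_measurable_continuous_onI continuous_intros)
  have sM: "(\<lambda>n. s n * M n) \<longlonglongrightarrow> zbar" and zbar_pos: "zbar > 0"
    using scaled_mean_abs_magnetization_tendsto[OF pos' BK_prod bK_pos s_small meas lim C]
    unfolding zbar' M_def by auto
  have "\<forall>\<^sub>F n in sequentially. (B n, K n) \<in> phase_coexistence"
    using hyp_i[OF alpha0] by (simp add: B_def K_def)
  from scaled_magnetization_tendsto[OF this s_pos lim hyp_iii_b]
  have sm: "(\<lambda>n. s n * m n) \<longlonglongrightarrow> xbar" by (simp add: m_def)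
  \<comment> \<open>\<open>M\<close> and \<open>m\<close> have the same order of decay \<open>1 / s n\<close>; their ratio gives the second claim\<close>
  have xbar_pos: "xbar > 0" using hyp_iii_b by blast
  have "M \<sim>[sequentially] (\<lambda>n. zbar / s n)"
  proof (rule asymp_equivI')
    have "(\<lambda>n. s n * M n / zbar) \<longlonglongrightarrow> zbar / zbar" using sM zbar_pos by (intro tendsto_intros) auto
    then show "(\<lambda>n. M n / (zbar / s n)) \<longlonglongrightarrow> 1" using zbar_pos by (simp add: mult.commute)
  qed
  moreover have "M \<sim>[sequentially] (\<lambda>n. zbar * m n / xbar)"
  proof (rule asymp_equivI')
    have "(\<lambda>n. (s n * M n) / (zbar * (s n * m n) / xbar)) \<longlonglongrightarrow> zbar / (zbar * xbar / xbar)"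
      using sM sm zbar_pos xbar_pos by (intro tendsto_intros) auto
    then have "(\<lambda>n. (s n * M n) / (zbar * (s n * m n) / xbar)) \<longlonglongrightarrow> 1"
      using zbar_pos xbar_pos by simp
    moreover have "\<forall>\<^sub>F n in sequentially.
        (s n * M n) / (zbar * (s n * m n) / xbar) = M n / (zbar * m n / xbar)"
      using s_pos by eventually_elim (simp add: field_simps)
    ultimately show "(\<lambda>n. M n / (zbar * m n / xbar)) \<longlonglongrightarrow> 1"
      by (rule Lim_transform_eventually)
  qed
  ultimately show ?thesis
    using sM unfolding M_def m_def s_def B_def K_def \<gamma>_def by blast
qed

end
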